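(* Let $Q$ be a quiver of type $A_n$ and fix $i\in I=\{1,\dots,n\}$. Then: (a) The cardinality $N_i(Q)$ of the $i$-th level of $\tilde\Gamma_Q$ is $$N_i(Q)=\frac{n+1+a_i-b_i}{2},$$ where $a_i$ (respectively $b_i$) is the number of arrows in the unoriented path from $i$ to $i^*$ that are directed towards $i$ (respectively towards $i^*$). (b) For $j=0,1,\ldots,N_i(Q)-1$ one has $$J^{(i)}_j(Q)=[c]_{\overline{m_i-j},\;i}\,,$$ where $c$ is the Coxeter element defined by $Q$.
   Context: Let $Q$ be an orientation of the Dynkin diagram of type $A_n$ with vertices $1,\dots,n$ (vertices $k$ and $k+1$ linked). The Weyl group is $W=\mathcal{S}_{n+1}$, with simple reflections $s_k=(k\ \,k+1)$ and products composed as functions (right factor first); $w_0$ is its longest element, $N=n(n+1)/2$ its length, and $i^*=n+1-i$. Adapted expressions: a vertex $k$ is a sink of $Q$ if all arrows incident to $k$ enter $k$; then $S_kQ$ is the quiver obtained by reversing all arrows ending at $k$. A word $s_{i_1}s_{i_2}\cdots s_{i_m}$ is adapted to $Q$ if $i_1$ is a sink of $Q$, $i_2$ a sink of $S_{i_1}Q$, $i_3$ a sink of $S_{i_2}S_{i_1}Q$, and so on. Levels: weights $w\omega_i$ in the $W$-orbit of the fundamental weight $\omega_i$ are identified with strictly increasing multi-indices of size $i$ with entries in $\{1,\dots,n+1\}$ (equivalently, $i$-element subsets) via $w\omega_i\leftrightarrow w\cdot\{1,\dots,i\}$. Let $\tilde w_0=s_{i_1}\cdots s_{i_N}$ be a reduced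 expression of $w_0$ adapted to $Q$, and let $\mu_k=s_{i_1}\cdots s_{i_k}(\omega_{i_k})$ for $1\le k\le N$. The $\mu_k$ are the vertices of the quiver $\tilde\Gamma_Q$; its $i$-th level is the tuple of the $\mu_k$ with $i_k=i$, ordered from left to right by increasing $k$. This level depends only on $Q$, and $N_i(Q)$ denotes its cardinality. $J^{(i)}_j(Q)$ is the multi-index of the $j$-th vertex from the right, counted starting with $0$, on this level (so $j=0$ corresponds to the largest $k$ with $i_k=i$). Coxeter element: $c=s_{j_1}s_{j_2}\cdots s_{j_n}$, where $(j_1,\dots,j_n)$ is a permutation of $\{1,\dots,n\}$ such that $j_1$ is a sink of $Q$, $j_2$ a sink of $S_{j_1}Q$, and so on (it is independent of the choice). It is an $(n+1)$-cycle, written $(x_1\,x_2\,\dots\,x_{n+1})$ with $c(x_k)=x_{k+1}$ and normalized by $x_{n+1}=n+1$; indices of $x$ are read modulo $n+1$, and $\overline{m}$ denotes $m$ modulo $n+1$. For an integer $m$ and $i\in I$, $[c]_{\overline{m},i}$ is the multi-index obtained by ordering increasingly the set $\{x_{\overline{m}},x_{\overline{m+1}},\dots,x_{\overline{m+i-1}}\}$. The residues $\overline{m}_i$ modulo $n+1$ are defined recursively by $\overline{m}_1=n+1$ and, for $2\le i\le n$, $\overline{m}_i=\overline{m}_{i-1}$ if the arrow between $i^*$ and $i^*+1$ in $Q$ is $i^*\to i^*+1$, and $\overline{m}_i=\overline{m}_{i-1}-1$ if it is $i^*\leftarrow i^*+1$; $\overline{m_i-j}$ denotes the residue $\overline{m}_i-j$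 modulo $n+1$. *)

theory Defs
  imports Complex_Main "HOL-Combinatorics.Combinatorics"
begin

text \<open>A quiver is given by its set of arrows; the pair \<open>(a, b)\<close> is the arrow from \<open>a\<close> to \<open>b\<close>.\<close>

type_synonym quiver = "(nat \<times> nat) set"

definition type_A_quiver :: "nat \<Rightarrow> quiver \<Rightarrow> bool" where
  "type_A_quiver n Q \<longleftrightarrow>
     Q \<subseteq> (\<Union>k\<in>{1..<n}. {(k, k + 1), (k + 1, k)}) \<and>
     (\<forall>k\<in>{1..<n}. (k, k + 1) \<in> Q \<longleftrightarrow> (k + 1, k) \<notin> Q)"

definition star :: "nat \<Rightarrow> nat \<Rightarrow> nat" where
  "star n i = n + 1 - i"

definition is_sink :: "nat \<Rightarrow> quiver \<Rightarrow> nat \<Rightarrow> bool" where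
  "is_sink n Q k \<longleftrightarrow> k \<in> {1..n} \<and> (\<forall>(a, b)\<in>Q. a = k \<or> b = k \<longrightarrow> b = k)"

definition reflect_quiver :: "nat \<Rightarrow> quiver \<Rightarrow> quiver" where
  "reflect_quiver k Q = {(a, b) \<in> Q. b \<noteq> k} \<union> {(b, a) | a b. (a, b) \<in> Q \<and> b = k}"

text \<open>The word \<open>s\<^sub>i\<^sub>1 \<cdots> s\<^sub>i\<^sub>m\<close> is represented by the list \<open>[i\<^sub>1, \<dots>, i\<^sub>m]\<close>.\<close>

fun adapted :: "nat \<Rightarrow> quiver \<Rightarrow> nat list \<Rightarrow> bool" where
  "adapted n Q [] \<longleftrightarrow> True"
| "adapted n Q (k # ks) \<longleftrightarrow> is_sink n Q k \<and> adapted n (reflect_quiver k Q) ks"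

text \<open>The Weyl group of type \<open>A\<^sub>n\<close> consists of the \<open>w\<close> with \<open>w permutes {1..n + 1}\<close>.\<close>

definition simple_reflection :: "nat \<Rightarrow> nat \<Rightarrow> nat" where
  "simple_reflection k = transpose k (k + 1)"

definition word_perm :: "nat list \<Rightarrow> nat \<Rightarrow> nat" where
  "word_perm ws = foldr (\<lambda>k w. simple_reflection k \<circ> w) ws id"

definition weyl_length :: "nat \<Rightarrow> (nat \<Rightarrow> nat) \<Rightarrow> nat" where
  "weyl_length n w = (LEAST m. \<exists>ws. set ws \<subseteq> {1..n} \<and> word_perm ws = w \<and> length ws = m)"

definition reduced_expression :: "nat \<Rightarrow> (nat \<Rightarrow> nat) \<Rightarrow> nat list \<Rightarrow> bool" where
  "reduced_expression n w ws \<longleftrightarrow>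
     set ws \<subseteq> {1..n} \<and> word_perm ws = w \<and> length ws = weyl_length n w"

definition longest_element :: "nat \<Rightarrow> nat \<Rightarrow> nat" where
  "longest_element n = (ARG_MAX (weyl_length n) w. w permutes {1..n + 1})"

text \<open>
  The weight \<open>w \<omega>\<^sub>i\<close> is identified with the increasing listing of \<open>w {1, \<dots>, i}\<close>.
  In \<open>mu ws k\<close> the index \<open>k\<close> runs from \<open>1\<close> to \<open>length ws\<close>, so that the letter
  \<open>i\<^sub>k\<close> is \<open>ws ! (k - 1)\<close>.
\<close>

definition weight_index :: "(nat \<Rightarrow> nat) \<Rightarrow> nat \<Rightarrow> nat list" where
  "weight_index w i = sorted_list_of_set (w ` {1..i})"

definition mu :: "nat list \<Rightarrow> nat \<Rightarrow> nat list" where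
  "mu ws k = weight_index (word_perm (take k ws)) (ws ! (k - 1))"

definition level :: "nat list \<Rightarrow> nat \<Rightarrow> nat list list" where
  "level ws i = map (mu ws) (filter (\<lambda>k. ws ! (k - 1) = i) [1..<length ws + 1])"

definition level_size :: "nat list \<Rightarrow> nat \<Rightarrow> nat" where
  "level_size ws i = length (level ws i)"

definition level_index :: "nat list \<Rightarrow> nat \<Rightarrow> nat \<Rightarrow> nat list" where
  "level_index ws i j = rev (level ws i) ! j"

text \<open>
  The number of arrows on the path between \<open>p\<close> and \<open>q\<close> that are directed towards \<open>p\<close>, i.e. whose
  head is closer to \<open>p\<close> than their tail.
\<close>

definition arrows_towards :: "quiver \<Rightarrow> nat \<Rightarrow> nat \<Rightarrow> nat" where
  "arrows_towards Q p q =
     card {(a, b) \<in> Q. a \<in> {min p q..max p q} \<and> b \<in> {min p q..max p q} \<and>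
                       \<bar>int b - int p\<bar> < \<bar>int a - int p\<bar>}"

definition coxeter_element :: "nat \<Rightarrow> quiver \<Rightarrow> (nat \<Rightarrow> nat) \<Rightarrow> bool" where
  "coxeter_element n Q c \<longleftrightarrow>
     (\<exists>js. distinct js \<and> set js = {1..n} \<and> adapted n Q js \<and> c = word_perm js)"

text \<open>
  \<open>xs\<close> is the list \<open>[x\<^sub>1, \<dots>, x\<^sub>n\<^sub>+\<^sub>1]\<close> of the normalized cycle notation of \<open>c\<close>;
  \<^const>\<open>cycle_of_list\<close> sends each entry to the next one.
\<close>

definition normalized_cycle :: "nat \<Rightarrow> (nat \<Rightarrow> nat) \<Rightarrow> nat list \<Rightarrow> bool" where
  "normalized_cycle n c xs \<longleftrightarrow>
     distinct xs \<and> set xs = {1..n + 1} \<and> c = cycle_of_list xs \<and> last xs = n + 1"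

text \<open>The entry \<open>x\<^sub>m\<close>, with \<open>m\<close> read modulo \<open>n + 1\<close>; list positions start at \<open>0\<close>.\<close>

definition cyclic_entry :: "nat \<Rightarrow> nat list \<Rightarrow> int \<Rightarrow> nat" where
  "cyclic_entry n xs m = xs ! nat ((m - 1) mod (int n + 1))"

definition cycle_index :: "nat \<Rightarrow> nat list \<Rightarrow> int \<Rightarrow> nat \<Rightarrow> nat list" where
  "cycle_index n xs m i = sorted_list_of_set (cyclic_entry n xs ` {m..m + int i - 1})"

text \<open>
  An integer representative of the residue modulo \<open>n + 1\<close>, used only as an argument of
  \<^const>\<open>cycle_index\<close>. The recursion is meant for \<open>1 \<le> i \<le> n\<close>; the value at \<open>0\<close> is irrelevant.
\<close>

fun m_res :: "nat \<Rightarrow> quiver \<Rightarrow> nat \<Rightarrow> int" where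
  "m_res n Q 0 = int n + 1"
| "m_res n Q (Suc 0) = int n + 1"
| "m_res n Q (Suc (Suc k)) =
     (let i = k + 2 in
      if (star n i, star n i + 1) \<in> Q then m_res n Q (Suc k) else m_res n Q (Suc k) - 1)"

end

theory Submission
  imports Defs
begin

text \<open>
  Reflecting \<open>Q\<close> at a sink \<open>k\<close> conjugates its Coxeter element by \<open>s\<^sub>k\<close>. Hence, along an adapted
  word, the \<open>t\<close>-th vertex on level \<open>i\<close> is \<open>c\<^sup>t {1, \<dots>, i}\<close>, and the last one is
  \<open>w\<^sub>0 {1, \<dots>, i} = {i\<^sup>* + 1, \<dots>, n + 1}\<close>. This set is an interval of the cycle \<open>c\<close>: passing from
  \<open>i - 1\<close> to \<open>i\<close> adds the point \<open>a + 1\<close> with \<open>a = i\<^sup>*\<close>, which is entered from a larger point if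
  \<open>a \<rightarrow> a + 1\<close> and mapped to a larger point otherwise. Applying \<open>c\<close> backwards gives (b).

  For (a), each letter \<open>k\<close> or \<open>k + 1\<close> flips the arrow between \<open>k\<close> and \<open>k + 1\<close>, so \<open>N\<^sub>k\<^sub>+\<^sub>1 - N\<^sub>k\<close> is
  read off from the initial and the final quiver; the latter is the image of \<open>Q\<close> under \<open>i \<mapsto> i\<^sup>*\<close>
  because its Coxeter element is \<open>w\<^sub>0 c w\<^sub>0\<close>. It follows that \<open>N\<^sub>k + N\<^sub>k\<^sub>*\<close> does not depend on \<open>k\<close>,
  and its value is determined by the total length \<open>n (n + 1) / 2\<close>.
\<close>

section \<open>Length in the symmetric group\<close>

lemma word_perm_simps [simp]:
  "word_perm [] = id"
  "word_perm (k # ws) = simple_reflection k \<circ> word_perm ws"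
  by (simp_all add: word_perm_def)

lemma word_perm_append: "word_perm (us @ vs) = word_perm us \<circ> word_perm vs"
  by (induction us) (auto simp: comp_assoc)

lemma word_perm_snoc: "word_perm (ws @ [k]) = word_perm ws \<circ> simple_reflection k"
  by (simp only: word_perm_append word_perm_simps comp_id)

lemma simple_reflection_involutory [simp]:
  "simple_reflection k (simple_reflection k a) = a"
  "simple_reflection k \<circ> simple_reflection k = id"
  by (simp_all add: simple_reflection_def)

lemma simple_reflection_permutes: "k \<in> {1..n} \<Longrightarrow> simple_reflection k permutes {1..n + 1}"
  unfolding simple_reflection_def by (rule permutes_swap_id) auto

section \<open>Inversion counts and the length function\<close>

definition inversions :: "nat \<Rightarrow> (nat \<Rightarrow> nat) \<Rightarrow> (nat \<times> nat) set" where
  "inversions n w = {(a, b). 1 \<le> a \<and> a < b \<and> b \<le> n + 1 \<and> w b < w a}"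

definition increasing_pairs :: "nat \<Rightarrow> (nat \<times> nat) set" where
  "increasing_pairs n = {(a, b). 1 \<le> a \<and> a < b \<and> b \<le> n + 1}"

lemma finite_increasing_pairs: "finite (increasing_pairs n)"
  by (rule finite_subset[of _ "{..n + 1} \<times> {..n + 1}"]) (auto simp: increasing_pairs_def)

lemma inversions_subset: "inversions n w \<subseteq> increasing_pairs n"
  by (auto simp: inversions_def increasing_pairs_def)

lemma finite_inversions: "finite (inversions n w)"
  using inversions_subset finite_increasing_pairs by (rule finite_subset)

lemma card_increasing_pairs: "2 * card (increasing_pairs n) = n * (n + 1)"
proof -
  have "bij_betw prod.swap (SIGMA b:{1..n + 1}. {1..<b}) (increasing_pairs n)"
    by (rule bij_betwI[where g = prod.swap]) (auto simp: increasing_pairs_def)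
  then have "card (increasing_pairs n) = card (SIGMA b:{1..n + 1}. {1..<b})"
    by (metis bij_betw_same_card)
  also have "\<dots> = (\<Sum>b\<in>{1..n + 1}. b - 1)"
    by simp
  also have "2 * \<dots> = n * (n + 1)"
    by (induction n) auto
  finally show ?thesis .
qed

lemma simple_reflection_less:
  assumes "a < b" "(a, b) \<noteq> (k, k + 1)"
  shows "simple_reflection k a < simple_reflection k b"
  using assms by (auto simp: simple_reflection_def transpose_def)

lemma simple_reflection_bounds:
  assumes "k \<in> {1..n}" "1 \<le> a" "a \<le> n + 1"
  shows "1 \<le> simple_reflection k a" "simple_reflection k a \<le> n + 1"
  using assms by (auto simp: simple_reflection_def transpose_def)

text \<open>The reflection s_k reverses only the pair (k, k + 1), so every other inversion survives
  when both entries are transported. This one map yields the bound for a general letter and the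
  strict drop at a descent.\<close>

lemma map_prod_inversions:
  assumes "k \<in> {1..n}" "p \<in> inversions n (w \<circ> simple_reflection k)" "p \<noteq> (k, k + 1)"
  shows "map_prod (simple_reflection k) (simple_reflection k) p \<in> inversions n w"
proof -
  obtain a b where p: "p = (a, b)" by (cases p)
  then have "1 \<le> a" "a < b" "b \<le> n + 1" "w (simple_reflection k b) < w (simple_reflection k a)"
    using assms by (auto simp: inversions_def)
  then show ?thesis
    using simple_reflection_bounds[OF assms(1), of a] simple_reflection_bounds[OF assms(1), of b]
      simple_reflection_less[of a b k] assms(3) p
    by (auto simp: inversions_def)
qed

lemma card_inversions_step:
  assumes "k \<in> {1..n}"
  shows "card (inversions n (w \<circ> simple_reflection k)) \<le> Suc (card (inversions n w))"
proof -
  let ?f = "map_prod (simple_reflection k) (simple_reflection k)"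
  have "inversions n (w \<circ> simple_reflection k) \<subseteq> insert (k, k + 1) (?f ` inversions n w)"
  proof
    fix p assume p: "p \<in> inversions n (w \<circ> simple_reflection k)"
    have "p = ?f (?f p)" by (cases p) simp
    then show "p \<in> insert (k, k + 1) (?f ` inversions n w)"
      using map_prod_inversions[OF assms p] by blast
  qed
  then have "card (inversions n (w \<circ> simple_reflection k))
      \<le> card (insert (k, k + 1) (?f ` inversions n w))"
    by (intro card_mono) (auto simp: finite_inversions)
  also have "\<dots> \<le> Suc (card (?f ` inversions n w))"
    by (rule card_insert_le_m1) simp_all
  also have "\<dots> \<le> Suc (card (inversions n w))"
    by (simp add: card_image_le finite_inversions)
  finally show ?thesis .
qed

text \<open>At a descent, (k, k + 1) is an inversion of w but not of w s_k, so the injective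
  transport of inversions misses it.\<close>

lemma card_inversions_descent:
  assumes "k \<in> {1..n}" "w (k + 1) < w k"
  shows "card (inversions n (w \<circ> simple_reflection k)) < card (inversions n w)"
proof -
  let ?f = "map_prod (simple_reflection k) (simple_reflection k)"
  have neq: "p \<noteq> (k, k + 1)" if "p \<in> inversions n (w \<circ> simple_reflection k)" for p
    using that assms(2) by (auto simp: inversions_def simple_reflection_def)
  have "?f ` inversions n (w \<circ> simple_reflection k) \<subseteq> inversions n w - {(k, k + 1)}"
  proof
    fix q assume "q \<in> ?f ` inversions n (w \<circ> simple_reflection k)"
    then obtain p where p: "q = ?f p" "p \<in> inversions n (w \<circ> simple_reflection k)"
      by (rule imageE)
    then have "q \<in> inversions n w"
      using map_prod_inversions[OF assms(1) p(2) neq[OF p(2)]] by simp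
    moreover have "q \<noteq> (k, k + 1)"
    proof
      assume "q = (k, k + 1)"
      moreover have "p = ?f q" using p(1) by (cases p) simp
      ultimately show False
        using p(2) by (auto simp: inversions_def simple_reflection_def)
    qed
    ultimately show "q \<in> inversions n w - {(k, k + 1)}" by blast
  qed
  then have "card (?f ` inversions n (w \<circ> simple_reflection k)) \<le> card (inversions n w - {(k, k + 1)})"
    by (intro card_mono finite_Diff finite_inversions)
  also have "\<dots> < card (inversions n w)"
    by (rule card_Diff1_less[OF finite_inversions]) (use assms in \<open>simp add: inversions_def\<close>)
  also have "card (?f ` inversions n (w \<circ> simple_reflection k)) = card (inversions n (w \<circ> simple_reflection k))"
    by (rule card_image, rule inj_on_inverseI[where g = ?f]) (simp add: map_prod_def split_def)
  finally show ?thesis .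
qed

lemma card_inversions_word_perm:
  "set ws \<subseteq> {1..n} \<Longrightarrow> card (inversions n (word_perm ws)) \<le> length ws"
proof (induction ws rule: rev_induct)
  case Nil
  have "inversions n id = {}" by (auto simp: inversions_def)
  then show ?case by (simp only: word_perm_simps card.empty)
next
  case (snoc k ws)
  have "card (inversions n (word_perm ws \<circ> simple_reflection k))
      \<le> Suc (card (inversions n (word_perm ws)))"
    using snoc.prems by (intro card_inversions_step) auto
  also have "\<dots> \<le> length (ws @ [k])" using snoc by simp
  finally show ?case by (simp only: word_perm_snoc)
qed

text \<open>Being increasing forces k \<le> w k, and a permutation of an initial segment with this
  property fixes every point.\<close>

lemma increasing_permutation_is_id:
  fixes n :: nat
  assumes "w permutes {1..n + 1}" "\<And>k. k \<in> {1..n} \<Longrightarrow> w k < w (k + 1)"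
  shows "w = id"
proof (rule permutes_natset_ge[OF assms(1)])
  have "k \<le> n \<Longrightarrow> k + 1 \<le> w (k + 1)" for k
  proof (induction k)
    case 0
    have "w 1 \<in> {1..n + 1}" using permutes_in_image[OF assms(1), of 1] by simp
    then show ?case by simp
  next
    case (Suc k)
    then show ?case using assms(2)[of "Suc k"] by simp
  qed
  note le = this
  show "\<forall>i\<in>{1..n + 1}. i \<le> w i"
  proof
    fix i assume "i \<in> {1..n + 1}"
    then obtain j where "i = j + 1" "j \<le> n" by (cases i) auto
    then show "i \<le> w i" using le by simp
  qed
qed

text \<open>This is sorting: right multiplication by s_k at a descent lowers the inversion count,
  and a permutation without descents is the identity.\<close>

lemma word_of_card_inversions:
  assumes "w permutes {1..n + 1}"
  shows "\<exists>ws. set ws \<subseteq> {1..n} \<and> word_perm ws = w \<and> length ws \<le> card (inversions n w)"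
  using assms
proof (induction "card (inversions n w)" arbitrary: w rule: less_induct)
  case less
  show ?case
  proof (cases "\<exists>k\<in>{1..n}. w (k + 1) < w k")
    case True
    then obtain k where k: "k \<in> {1..n}" "w (k + 1) < w k" by blast
    let ?v = "w \<circ> simple_reflection k"
    have lt: "card (inversions n ?v) < card (inversions n w)"
      using k by (rule card_inversions_descent)
    have "?v permutes {1..n + 1}"
      using permutes_compose[OF simple_reflection_permutes[OF k(1)] less.prems] .
    then obtain ws where ws: "set ws \<subseteq> {1..n}" "word_perm ws = ?v"
      "length ws \<le> card (inversions n ?v)"
      using less.hyps[OF lt] by blast
    have "word_perm (ws @ [k]) = w"
      by (simp only: word_perm_snoc ws(2) comp_assoc simple_reflection_involutory comp_id)
    then show ?thesis
      using ws k lt by (intro exI[of _ "ws @ [k]"]) auto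
  next
    case False
    have "w k < w (k + 1)" if "k \<in> {1..n}" for k
    proof -
      have "w k \<noteq> w (k + 1)" using permutes_inj[OF less.prems] by (simp add: inj_eq)
      moreover have "\<not> w (k + 1) < w k" using that False by blast
      ultimately show ?thesis by simp
    qed
    then have "w = id" by (rule increasing_permutation_is_id[OF less.prems])
    then have "set [] \<subseteq> {1..n} \<and> word_perm [] = w \<and> length [] \<le> card (inversions n w)"
      by simp
    then show ?thesis by blast
  qed
qed

lemma weyl_length_eq_card_inversions:
  assumes "w permutes {1..n + 1}"
  shows "weyl_length n w = card (inversions n w)"
proof (rule antisym)
  let ?P = "\<lambda>m. \<exists>ws. set ws \<subseteq> {1..n} \<and> word_perm ws = w \<and> length ws = m"
  obtain us where us: "set us \<subseteq> {1..n}" "word_perm us = w" "length us \<le> card (inversions n w)"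
    using word_of_card_inversions[OF assms] by blast
  then have "?P (length us)" by blast
  then show "weyl_length n w \<le> card (inversions n w)"
    using us(3) unfolding weyl_length_def by (rule order_trans[OF Least_le])
  have "?P (weyl_length n w)"
    unfolding weyl_length_def using \<open>?P (length us)\<close> by (rule LeastI)
  then show "card (inversions n w) \<le> weyl_length n w"
    using card_inversions_word_perm by metis
qed

section \<open>The longest element\<close>

definition reversal :: "nat \<Rightarrow> nat \<Rightarrow> nat" where
  "reversal n a = (if a \<in> {1..n + 1} then n + 2 - a else a)"

lemma reversal_permutes: "reversal n permutes {1..n + 1}"
proof (rule bij_imp_permutes)
  show "bij_betw (reversal n) {1..n + 1} {1..n + 1}"
    by (rule bij_betwI[where g = "reversal n"]) (auto simp: reversal_def)
qed (auto simp: reversal_def)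

lemma reversal_reversal: "reversal n \<circ> reversal n = id"
  by (auto simp: reversal_def fun_eq_iff)

lemma inversions_reversal: "inversions n (reversal n) = increasing_pairs n"
  by (auto simp: inversions_def increasing_pairs_def reversal_def)

text \<open>If every pair is inverted, composing with the reversal gives an increasing permutation,
  hence the identity.\<close>

lemma eq_reversal_if_card_inversions:
  assumes w: "w permutes {1..n + 1}" and "card (inversions n w) = card (increasing_pairs n)"
  shows "w = reversal n"
proof -
  have all: "inversions n w = increasing_pairs n"
    using card_subset_eq[OF finite_increasing_pairs inversions_subset] assms(2) by blast
  have "reversal n \<circ> w = id"
  proof (rule increasing_permutation_is_id)
    show "reversal n \<circ> w permutes {1..n + 1}"
      by (rule permutes_compose[OF w reversal_permutes])
    fix k assume k: "k \<in> {1..n}"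
    then have "(k, k + 1) \<in> inversions n w"
      unfolding all by (simp add: increasing_pairs_def)
    then have "w (k + 1) < w k" by (simp add: inversions_def)
    moreover have "w k \<in> {1..n + 1}" "w (k + 1) \<in> {1..n + 1}"
      using k permutes_in_image[OF w] by auto
    ultimately show "(reversal n \<circ> w) k < (reversal n \<circ> w) (k + 1)"
      by (auto simp: reversal_def)
  qed
  then have "reversal n \<circ> (reversal n \<circ> w) = reversal n" by simp
  then show ?thesis by (simp add: comp_assoc[symmetric] reversal_reversal)
qed

lemma longest_element_eq_reversal: "longest_element n = reversal n"
proof -
  let ?P = "\<lambda>w. w permutes {1..n + 1}"
  have le: "weyl_length n w \<le> card (increasing_pairs n)" if "?P w" for w
    using that by (simp add: weyl_length_eq_card_inversions card_mono
        finite_increasing_pairs inversions_subset)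
  have "?P (longest_element n) \<and> (\<forall>w. ?P w \<longrightarrow> weyl_length n w \<le> weyl_length n (longest_element n))"
    unfolding longest_element_def
    \<comment> \<open>The existence of a maximum is drawn from a strict upper bound on the length,
      hence the \<open>Suc\<close>.\<close>
    by (rule arg_max_nat_lemma[where k = id and b = "Suc (card (increasing_pairs n))"])
      (auto simp: permutes_id less_Suc_eq_le le)
  then have P: "?P (longest_element n)"
    and ge: "weyl_length n (reversal n) \<le> weyl_length n (longest_element n)"
    using reversal_permutes by blast+
  then have "card (inversions n (longest_element n)) = card (increasing_pairs n)"
    using le[OF P] reversal_permutes
    by (simp add: weyl_length_eq_card_inversions inversions_reversal)
  then show ?thesis by (rule eq_reversal_if_card_inversions[OF P])
qed

lemma reduced_expression_longest:
  assumes "reduced_expression n (longest_element n) ws"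
  shows "set ws \<subseteq> {1..n}" "word_perm ws = reversal n" "2 * length ws = n * (n + 1)"
proof -
  have red: "set ws \<subseteq> {1..n} \<and> word_perm ws = reversal n \<and> length ws = weyl_length n (reversal n)"
    using assms unfolding reduced_expression_def longest_element_eq_reversal .
  then show "set ws \<subseteq> {1..n}" "word_perm ws = reversal n" by blast+
  have "length ws = card (increasing_pairs n)"
    using red weyl_length_eq_card_inversions[OF reversal_permutes] inversions_reversal by metis
  then show "2 * length ws = n * (n + 1)" using card_increasing_pairs by metis
qed

section \<open>Quivers and Coxeter elements\<close>

lemma reflect_quiver_iff:
  "(a, b) \<in> reflect_quiver k Q \<longleftrightarrow> (a, b) \<in> Q \<and> b \<noteq> k \<or> (b, a) \<in> Q \<and> a = k"
  by (auto simp: reflect_quiver_def)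

lemma type_A_quiver_reverse:
  assumes "type_A_quiver n Q" "k \<in> {1..<n}"
  shows "(k + 1, k) \<in> Q \<longleftrightarrow> (k, k + 1) \<notin> Q"
  using assms unfolding type_A_quiver_def by blast

lemma type_A_quiver_reflect:
  assumes "type_A_quiver n Q"
  shows "type_A_quiver n (reflect_quiver k Q)"
proof -
  have "reflect_quiver k Q \<subseteq> (\<Union>k\<in>{1..<n}. {(k, k + 1), (k + 1, k)})"
  proof safe
    fix a b assume "(a, b) \<in> reflect_quiver k Q"
    then have "(a, b) \<in> Q \<or> (b, a) \<in> Q" by (auto simp: reflect_quiver_iff)
    then show "(a, b) \<in> (\<Union>k\<in>{1..<n}. {(k, k + 1), (k + 1, k)})"
      using assms unfolding type_A_quiver_def by blast
  qed
  moreover have "(j, j + 1) \<in> reflect_quiver k Q \<longleftrightarrow> (j + 1, j) \<notin> reflect_quiver k Q"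
    if "j \<in> {1..<n}" for j
    using type_A_quiver_reverse[OF assms that] by (auto simp: reflect_quiver_iff)
  ultimately show ?thesis unfolding type_A_quiver_def by blast
qed

lemma type_A_quiver_fold_reflect:
  "type_A_quiver n Q \<Longrightarrow> type_A_quiver n (fold reflect_quiver ws Q)"
  by (induction ws arbitrary: Q) (auto simp: type_A_quiver_reflect)

lemma is_sink_no_out:
  assumes "is_sink n Q k" "b \<noteq> k"
  shows "(k, b) \<notin> Q"
  using assms by (auto simp: is_sink_def)

lemma adapted_append:
  "adapted n Q (us @ vs) \<longleftrightarrow> adapted n Q us \<and> adapted n (fold reflect_quiver us Q) vs"
  by (induction us arbitrary: Q) auto

text \<open>
  The product of the reflections \<open>s\<^sub>k\<close> with \<open>k \<in> S\<close>, \<open>k \<le> m\<close>, in which \<open>s\<^sub>k\<^sub>+\<^sub>1\<close> stands to the left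
  of \<open>s\<^sub>k\<close> exactly when \<open>Q\<close> has the arrow \<open>k \<rightarrow> k + 1\<close>. The set \<open>S\<close> makes it possible to
  split off a single factor.
\<close>

fun cox :: "quiver \<Rightarrow> nat set \<Rightarrow> nat \<Rightarrow> nat \<Rightarrow> nat" where
  "cox Q S 0 = id"
| "cox Q S (Suc m) =
     (if Suc m \<in> S then
        if m \<in> S \<and> (m, Suc m) \<in> Q then simple_reflection (Suc m) \<circ> cox Q S m
        else cox Q S m \<circ> simple_reflection (Suc m)
      else cox Q S m)"

lemma simple_reflection_commute:
  assumes "k + 2 \<le> m"
  shows "simple_reflection k \<circ> simple_reflection m = simple_reflection m \<circ> simple_reflection k"
  using assms by (auto simp: simple_reflection_def transpose_def fun_eq_iff)

lemma simple_reflection_cox_commute: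
  assumes "m + 2 \<le> r"
  shows "simple_reflection r \<circ> cox Q S m = cox Q S m \<circ> simple_reflection r"
  using assms
proof (induction m)
  case (Suc m)
  then have IH: "simple_reflection r \<circ> cox Q S m = cox Q S m \<circ> simple_reflection r"
    by linarith
  have "simple_reflection (Suc m) \<circ> simple_reflection r = simple_reflection r \<circ> simple_reflection (Suc m)"
    using simple_reflection_commute[of "Suc m" r] Suc.prems by linarith
  with IH[symmetric] show ?case by (simp add: fun_eq_iff)
qed simp

lemma cox_permutes:
  assumes "m \<le> n"
  shows "cox Q S m permutes {1..n + 1}"
  using assms
proof (induction m)
  case (Suc m)
  then have "cox Q S m permutes {1..n + 1}" "simple_reflection (Suc m) permutes {1..n + 1}"
    using simple_reflection_permutes[of "Suc m" n] by auto
  then show ?case by (auto intro: permutes_compose)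
qed (simp add: permutes_id)

lemma cox_cong:
  assumes "\<And>j. j \<in> S \<Longrightarrow> Suc j \<in> S \<Longrightarrow> (j, Suc j) \<in> Q \<longleftrightarrow> (j, Suc j) \<in> R"
  shows "cox Q S m = cox R S m"
  using assms by (induction m) auto

lemma cox_insert_beyond: "m < k \<Longrightarrow> cox Q (insert k S) m = cox Q S m"
  by (induction m) auto

text \<open>At a sink, s_k stands to the left of both neighbouring reflections and commutes with all
  others, so it can be pulled to the front.\<close>

lemma cox_insert_sink:
  assumes "k \<notin> S" "k \<in> {1..m}" "k - 1 \<in> S \<Longrightarrow> (k - 1, k) \<in> Q" "(k, k + 1) \<notin> Q"
  shows "cox Q (insert k S) m = simple_reflection k \<circ> cox Q S m"
proof -
  have "k \<le> m" using assms(2) by simp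
  then show ?thesis
  proof (induction m rule: dec_induct)
    case base
    obtain j where k: "k = Suc j" using assms(2) by (cases k) auto
    show ?case
    proof (cases "j \<in> S")
      case True
      then show ?thesis using assms k by (simp add: cox_insert_beyond)
    next
      case False
      \<comment> \<open>Without s_j, only reflections with index at most k - 2 remain, and these
        commute with s_k.\<close>
      have "simple_reflection k \<circ> cox Q S j = cox Q S j \<circ> simple_reflection k"
      proof (cases j)
        case (Suc l)
        then have "cox Q S j = cox Q S l" using False by simp
        then show ?thesis using simple_reflection_cox_commute[of l k Q S] Suc k by simp
      qed simp
      then show ?thesis using assms k False by (simp add: cox_insert_beyond)
    qed
  next
    case (step m)
    have "simple_reflection (Suc m) \<circ> simple_reflection k =
        simple_reflection k \<circ> simple_reflection (Suc m)" if "m \<noteq> k"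
      using simple_reflection_commute[of k "Suc m"] that step.hyps by simp
    then show ?case
      using step assms by (cases "m = k") (auto simp: fun_eq_iff)
  qed
qed

text \<open>Dual to the sink case: s_k stands to the right of both neighbours and can be pushed to
  the end.\<close>

lemma cox_insert_source:
  assumes "k \<notin> S" "k \<in> {1..m}" "(k - 1, k) \<notin> Q" "k + 1 \<in> S \<Longrightarrow> (k, k + 1) \<in> Q"
  shows "cox Q (insert k S) m = cox Q S m \<circ> simple_reflection k"
proof -
  obtain j where k: "k = Suc j" using assms(2) by (cases k) auto
  have "k \<le> m" using assms(2) by simp
  then show ?thesis
  proof (induction m rule: dec_induct)
    case base
    show ?case using assms k by (simp add: cox_insert_beyond)
  next
    case (step m)
    show ?case
    proof (cases "m = k")
      case True
      have "simple_reflection (Suc k) \<circ> cox Q S k = cox Q S k \<circ> simple_reflection (Suc k)"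
        using simple_reflection_cox_commute[of j "Suc k" Q S] assms(1) k by simp
      then show ?thesis using step assms True by (auto simp: fun_eq_iff)
    next
      case False
      have "simple_reflection (Suc m) \<circ> simple_reflection k =
          simple_reflection k \<circ> simple_reflection (Suc m)"
        using simple_reflection_commute[of k "Suc m"] False step.hyps by simp
      then show ?thesis using step assms False by (auto simp: fun_eq_iff)
    qed
  qed
qed

lemma cox_insert_is_sink:
  assumes "type_A_quiver n Q" "is_sink n Q k" "k \<notin> S" "S \<subseteq> {1..n}"
  shows "cox Q (insert k S) n = simple_reflection k \<circ> cox Q S n"
proof (rule cox_insert_sink)
  show "k \<in> {1..n}" using assms(2) by (simp add: is_sink_def)
  show "(k - 1, k) \<in> Q" if "k - 1 \<in> S"
  proof -
    have "k - 1 \<in> {1..<n}" "k - 1 + 1 = k" using that assms(4) \<open>k \<in> {1..n}\<close> by auto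
    then show ?thesis
      using type_A_quiver_reverse[OF assms(1), of "k - 1"] is_sink_no_out[OF assms(2), of "k - 1"]
      by auto
  qed
  show "(k, k + 1) \<notin> Q" using is_sink_no_out[OF assms(2), of "k + 1"] by simp
qed fact

text \<open>Reflecting at k changes only arrows at k, while the product over S sees only arrows
  between members of S.\<close>

lemma cox_reflect_away:
  assumes "k \<notin> S"
  shows "cox (reflect_quiver k Q) S m = cox Q S m"
  using assms by (intro cox_cong) (auto simp: reflect_quiver_iff)

text \<open>Since k does not recur, the reflection at k is invisible to the product of the later
  letters; s_k is then put in front because k is a sink of the original quiver.\<close>

lemma word_perm_adapted_distinct:
  assumes "type_A_quiver n Q" "adapted n Q js" "distinct js"
  shows "set js \<subseteq> {1..n} \<and> word_perm js = cox Q (set js) n"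
  using assms
proof (induction js arbitrary: Q)
  case Nil
  have "cox Q {} m = id" for m by (induction m) auto
  then show ?case by simp
next
  case (Cons k js)
  have "set js \<subseteq> {1..n} \<and> word_perm js = cox (reflect_quiver k Q) (set js) n"
    using Cons.prems type_A_quiver_reflect by (intro Cons.IH) auto
  moreover have "k \<notin> set js" "is_sink n Q k" using Cons.prems by auto
  ultimately show ?case
    using cox_insert_is_sink[OF Cons.prems(1), of k "set js"]
    by (simp add: cox_reflect_away is_sink_def)
qed

section \<open>Conjugation of the Coxeter element by reflections at sinks\<close>

abbreviation full_cox :: "nat \<Rightarrow> quiver \<Rightarrow> nat \<Rightarrow> nat" where
  "full_cox n Q \<equiv> cox Q {1..n} n"

text \<open>The right-hand side mentions no word, so this also gives independence of the adapted
  ordering.\<close>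

lemma coxeter_element_eq:
  assumes "type_A_quiver n Q" "coxeter_element n Q c"
  shows "c = full_cox n Q"
  using assms word_perm_adapted_distinct unfolding coxeter_element_def by metis

lemma full_cox_sink:
  assumes "type_A_quiver n Q" "is_sink n Q k"
  shows "full_cox n Q = simple_reflection k \<circ> cox Q ({1..n} - {k}) n"
proof -
  have "insert k ({1..n} - {k}) = {1..n}" using assms(2) by (auto simp: is_sink_def)
  then show ?thesis using cox_insert_is_sink[OF assms, of "{1..n} - {k}"] by auto
qed

text \<open>Let d be the product without s_k. Then the Coxeter element of Q is s_k d, and that of
  the reflected quiver is d s_k because k has become a source.\<close>

lemma full_cox_reflect:
  assumes "type_A_quiver n Q" "is_sink n Q k"
  shows "full_cox n Q \<circ> simple_reflection k = simple_reflection k \<circ> full_cox n (reflect_quiver k Q)"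
proof -
  let ?S = "{1..n} - {k}" and ?R = "reflect_quiver k Q"
  have k: "k \<in> {1..n}" using assms(2) by (simp add: is_sink_def)
  have "(k, k + 1) \<in> ?R" if "k + 1 \<in> ?S"
    using that k type_A_quiver_reverse[OF assms(1), of k] is_sink_no_out[OF assms(2), of "k + 1"]
    by (auto simp: reflect_quiver_iff)
  moreover have "(k - 1, k) \<notin> ?R"
    using k by (auto simp: reflect_quiver_iff)
  ultimately have "cox ?R (insert k ?S) n = cox ?R ?S n \<circ> simple_reflection k"
    using k by (intro cox_insert_source) auto
  moreover have "insert k ?S = {1..n}" using k by auto
  ultimately have "full_cox n ?R = cox Q ?S n \<circ> simple_reflection k"
    by (simp add: cox_reflect_away)
  then show ?thesis by (simp only: full_cox_sink[OF assms] comp_assoc)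
qed

lemma full_cox_word_perm:
  assumes "type_A_quiver n Q" "adapted n Q ws"
  shows "full_cox n Q \<circ> word_perm ws = word_perm ws \<circ> full_cox n (fold reflect_quiver ws Q)"
  using assms
proof (induction ws arbitrary: Q)
  case (Cons k ws)
  let ?R = "reflect_quiver k Q"
  have "full_cox n ?R \<circ> word_perm ws = word_perm ws \<circ> full_cox n (fold reflect_quiver ws ?R)"
    using Cons.prems type_A_quiver_reflect by (intro Cons.IH) auto
  moreover have "full_cox n Q \<circ> simple_reflection k =
      simple_reflection k \<circ> full_cox n (reflect_quiver k Q)"
    using Cons.prems by (intro full_cox_reflect) auto
  ultimately show ?case by (metis comp_assoc word_perm_simps(2) fold_simps(2))
qed simp

section \<open>The action on initial segments\<close>

lemma simple_reflection_image_initial: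
  assumes "k \<noteq> i" "k \<ge> 1"
  shows "simple_reflection k ` {1..i} = {1..i}"
proof (cases "k < i")
  case True
  then show ?thesis
    using permutes_image[OF simple_reflection_permutes[of k "i - 1"]] assms by auto
next
  case False
  then have "simple_reflection k a = a" if "a \<in> {1..i}" for a
    using that assms by (auto simp: simple_reflection_def transpose_def)
  then show ?thesis by auto
qed

lemma cox_image_initial:
  assumes "i \<notin> S"
  shows "cox Q S m ` {1..i} = {1..i}"
proof (induction m)
  case (Suc m)
  have "simple_reflection (Suc m) ` {1..i} = {1..i}" if "Suc m \<in> S"
    using that assms by (intro simple_reflection_image_initial) auto
  then show ?case by (simp only: cox.simps image_comp[symmetric] Suc.IH split: if_split) (use Suc.IH in simp)
qed simp

lemma full_cox_image_sink:
  assumes "type_A_quiver n Q" "is_sink n Q i"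
  shows "full_cox n Q ` {1..i} = simple_reflection i ` {1..i}"
proof -
  have "full_cox n Q ` {1..i} = simple_reflection i ` cox Q ({1..n} - {i}) n ` {1..i}"
    unfolding full_cox_sink[OF assms] by (rule image_comp[symmetric])
  then show ?thesis by (simp only: cox_image_initial[of i "{1..n} - {i}"] Diff_iff insertI1 simp_thms)
qed

text \<open>With s_(a+1) on the left, a + 1 is first sent to at most a and stays there, while a + 2
  is sent to a + 1. Factors of larger index fix all points up to a + 1, so they preserve both
  facts.\<close>

lemma cox_arrow_right:
  assumes "a \<in> S" "Suc a \<in> S" "(a, Suc a) \<in> Q" "Suc a \<le> m" "1 \<le> a"
  shows "cox Q S m (Suc a) \<le> a \<and> (\<exists>y>Suc a. cox Q S m y = Suc a)"
  using assms(4)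
proof (induction m rule: dec_induct)
  case base
  have perm: "cox Q S a permutes {1..a + 1}" by (rule cox_permutes) simp
  obtain j where a: "a = Suc j" using assms(5) by (cases a) auto
  have "cox Q S j (Suc j) \<in> {1..j + 1}"
    using permutes_in_image[OF cox_permutes[of j j Q S]] by simp
  moreover have "cox Q S j (Suc a) = Suc a"
    using permutes_not_in[OF cox_permutes[of j j Q S]] a by simp
  ultimately have le: "cox Q S a (Suc a) \<le> a"
    using a assms(1) by (auto simp: simple_reflection_def)
  have "cox Q S a (Suc (Suc a)) = Suc (Suc a)"
    using permutes_not_in[OF perm] by simp
  then show ?case
    using assms le by (auto simp: simple_reflection_def intro!: exI[of _ "Suc (Suc a)"])
next
  case (step m)
  then obtain y where y: "cox Q S m (Suc a) \<le> a" "y > Suc a" "cox Q S m y = Suc a" by blast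
  let ?s = "simple_reflection (Suc m)"
  have s: "?s b = b" if "b \<le> Suc a" for b
    using that step.hyps by (simp add: simple_reflection_def)
  have gt: "?s y > Suc a"
    using y step.hyps by (auto simp: simple_reflection_def transpose_def)
  \<comment> \<open>If the new factor stands on the right, the preimage of a + 1 moves from y to its
    reflection.\<close>
  have "\<exists>z>Suc a. cox Q S m (?s z) = Suc a"
    using gt y by (intro exI[of _ "?s y"]) simp
  then show ?case using y s by auto
qed

text \<open>Now s_(a+1) acts first and lifts a + 1 to a + 2, which the earlier factors fix; later
  factors cannot bring a value above a + 1 back down.\<close>

lemma cox_arrow_left:
  assumes "a \<in> S" "Suc a \<in> S" "(a, Suc a) \<notin> Q" "Suc a \<le> m"
  shows "cox Q S m (Suc a) > Suc a"
  using assms(4)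
proof (induction m rule: dec_induct)
  case base
  have perm: "cox Q S a permutes {1..a + 1}" by (rule cox_permutes) simp
  have "cox Q S a (Suc (Suc a)) = Suc (Suc a)"
    using permutes_not_in[OF perm] by simp
  then show ?case using assms by (simp add: simple_reflection_def)
next
  case (step m)
  then show ?case by (auto simp: simple_reflection_def transpose_def)
qed

lemma full_cox_less_iff:
  assumes "a \<in> {1..<n}"
  shows "full_cox n Q (a + 1) < a + 1 \<longleftrightarrow> (a, a + 1) \<in> Q"
  using assms cox_arrow_right[of a "{1..n}" Q n] cox_arrow_left[of a "{1..n}" Q n]
  by (cases "(a, a + 1) \<in> Q") auto

section \<open>The levels\<close>

lemma adapted_set: "adapted n Q ws \<Longrightarrow> set ws \<subseteq> {1..n}"
  by (induction ws arbitrary: Q) (auto simp: is_sink_def)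

text \<open>
  When \<open>i\<close> is a sink, the Coxeter element acts on \<open>{1, \<dots>, i}\<close> as \<open>s\<^sub>i\<close>, so
  conjugating it along an adapted word turns each letter \<open>i\<close> into one application of \<open>c\<close>.
\<close>

lemma word_perm_image_initial:
  assumes "type_A_quiver n Q" "adapted n Q ws"
  shows "word_perm ws ` {1..i} = (full_cox n Q ^^ count_list ws i) ` {1..i}"
  using assms(2)
proof (induction ws rule: rev_induct)
  case (snoc k ws)
  let ?R = "fold reflect_quiver ws Q"
  have ad: "adapted n Q ws" "is_sink n ?R k" using snoc.prems by (auto simp: adapted_append)
  note IH = snoc.IH[OF ad(1)]
  show ?case
  proof (cases "k = i")
    case True
    have "word_perm (ws @ [k]) ` {1..i} = word_perm ws ` simple_reflection i ` {1..i}"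
      by (simp only: True word_perm_snoc image_comp)
    also have "\<dots> = (word_perm ws \<circ> full_cox n ?R) ` {1..i}"
      using full_cox_image_sink[OF type_A_quiver_fold_reflect[OF assms(1)]] ad(2) True
      by (metis image_comp)
    also have "\<dots> = full_cox n Q ` word_perm ws ` {1..i}"
      by (simp only: full_cox_word_perm[OF assms(1) ad(1), symmetric] image_comp)
    also have "\<dots> = (full_cox n Q ^^ Suc (count_list ws i)) ` {1..i}"
      by (simp only: IH image_comp funpow.simps)
    also have "Suc (count_list ws i) = count_list (ws @ [k]) i"
      using True by simp
    finally show ?thesis .
  next
    case False
    have "1 \<le> k" using ad(2) by (simp add: is_sink_def)
    have "word_perm (ws @ [k]) ` {1..i} = word_perm ws ` simple_reflection k ` {1..i}"
      by (simp only: word_perm_snoc image_comp)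
    then show ?thesis
      using IH False simple_reflection_image_initial[OF False \<open>1 \<le> k\<close>] by simp
  qed
qed simp

text \<open>A vertex depends only on the prefix ending in its letter, so levels can be built by
  induction from the right.\<close>

lemma level_snoc:
  "level (ws @ [k]) i = level ws i @ (if k = i then [weight_index (word_perm (ws @ [k])) i] else [])"
proof -
  let ?N = "length ws"
  have upt: "[1..<length (ws @ [k]) + 1] = [1..<?N + 1] @ [?N + 1]" by simp
  have "filter (\<lambda>l. (ws @ [k]) ! (l - 1) = i) [1..<?N + 1] = filter (\<lambda>l. ws ! (l - 1) = i) [1..<?N + 1]"
    by (rule filter_cong) (auto simp: nth_append)
  moreover have "mu (ws @ [k]) l = mu ws l" if "l \<in> set [1..<?N + 1]" for l
    using that by (auto simp: mu_def nth_append)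
  moreover have "mu (ws @ [k]) (?N + 1) = weight_index (word_perm (ws @ [k])) k"
    by (simp add: mu_def)
  ultimately show ?thesis
    unfolding level_def upt filter_append map_append by (auto simp del: upt_Suc)
qed

text \<open>The prefix defining a vertex includes the vertex's own letter, hence the exponent
  \<open>Suc t\<close> for an occurrence numbered from 0.\<close>

lemma level_eq:
  assumes "type_A_quiver n Q" "adapted n Q ws"
  shows "level ws i =
    map (\<lambda>t. sorted_list_of_set ((full_cox n Q ^^ Suc t) ` {1..i})) [0..<count_list ws i]"
  using assms(2)
proof (induction ws rule: rev_induct)
  case Nil
  show ?case by (simp add: level_def)
next
  case (snoc k ws)
  have "weight_index (word_perm (ws @ [k])) i =
      sorted_list_of_set ((full_cox n Q ^^ count_list (ws @ [k]) i) ` {1..i})"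
    unfolding weight_index_def using word_perm_image_initial[OF assms(1) snoc.prems] by simp
  moreover have "adapted n Q ws" using snoc.prems by (simp add: adapted_append)
  ultimately show ?case
    using snoc.IH by (cases "k = i") (simp_all add: level_snoc del: funpow.simps)
qed

lemma level_size_eq_count:
  assumes "type_A_quiver n Q" "adapted n Q ws"
  shows "level_size ws i = count_list ws i"
  by (simp add: level_size_def level_eq[OF assms])

lemma level_index_eq:
  assumes "type_A_quiver n Q" "adapted n Q ws" "j < count_list ws i"
  shows "level_index ws i j =
    sorted_list_of_set ((full_cox n Q ^^ (count_list ws i - j)) ` {1..i})"
proof -
  have "Suc (count_list ws i - Suc j) = count_list ws i - j" using assms(3) by simp
  then show ?thesis
    using assms(3) by (simp add: level_index_def level_eq[OF assms(1,2)] rev_nth del: funpow.simps)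
qed

section \<open>Cyclic intervals\<close>

text \<open>The cycle rotates its list by one, and wrapping around the end of the list is reduction
  modulo n + 1.\<close>

lemma cyclic_entry_Suc:
  assumes "normalized_cycle n c xs"
  shows "c (cyclic_entry n xs m) = cyclic_entry n xs (m + 1)"
proof -
  have xs: "distinct xs" "set xs = {1..n + 1}" "c = cycle_of_list xs"
    using assms by (auto simp: normalized_cycle_def)
  have len: "length xs = n + 1" using distinct_card[OF xs(1)] xs(2) by simp
  define t where "t = nat ((m - 1) mod (int n + 1))"
  have t: "t < length xs" "int t = (m - 1) mod (int n + 1)"
    using len pos_mod_bound[of "int n + 1" "m - 1"] by (auto simp: t_def nat_less_iff)
  have "map c xs = rotate1 xs"
    using cyclic_rotation[OF xs(1), of 1] xs(3) by simp
  then have "c (xs ! t) = rotate1 xs ! t"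
    using t by (metis nth_map)
  also have "\<dots> = xs ! (Suc t mod (n + 1))"
    using nth_rotate1[OF t(1)] len by simp
  also have "Suc t mod (n + 1) = nat ((m + 1 - 1) mod (int n + 1))"
  proof -
    have "int (Suc t mod (n + 1)) = (int t + 1) mod (int n + 1)"
      by (simp add: zmod_int add.commute)
    also have "\<dots> = (m - 1 + 1) mod (int n + 1)"
      unfolding t(2) by (rule mod_add_left_eq)
    finally show ?thesis by simp
  qed
  finally show ?thesis by (simp add: cyclic_entry_def t_def)
qed

lemma cyclic_entry_end:
  assumes "normalized_cycle n c xs"
  shows "cyclic_entry n xs (int n + 1) = n + 1"
proof -
  have xs: "distinct xs" "set xs = {1..n + 1}" "last xs = n + 1"
    using assms by (auto simp: normalized_cycle_def)
  have len: "length xs = n + 1" using distinct_card[OF xs(1)] xs(2) by simp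
  then have "xs ! n = n + 1" using xs(3) last_conv_nth[of xs] by (cases xs) auto
  then show ?thesis by (simp add: cyclic_entry_def)
qed

lemma funpow_cyclic_interval:
  assumes "normalized_cycle n c xs"
  shows "(c ^^ j) ` cyclic_entry n xs ` {a - int j..b - int j} = cyclic_entry n xs ` {a..b}"
proof -
  have *: "(c ^^ j) (cyclic_entry n xs m) = cyclic_entry n xs (m + int j)" for m
    by (induction j) (simp_all add: cyclic_entry_Suc[OF assms] add.assoc add.commute[of 1])
  have "(c ^^ j) ` cyclic_entry n xs ` {a - int j..b - int j}
      = cyclic_entry n xs ` (\<lambda>m. m + int j) ` {a - int j..b - int j}"
    by (simp only: image_image *)
  also have "(\<lambda>m. m + int j) ` {a - int j..b - int j} = {a..b}"
    by (simp only: image_add_atLeastAtMost' diff_add_cancel)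
  finally show ?thesis .
qed

text \<open>As c raises indices by one, an interval of the cycle can be entered only at its left end
  and left only at its right end. This locates a point that is to be adjoined.\<close>

lemma cyclic_interval_step:
  fixes n m c xs
  defines "x \<equiv> cyclic_entry n xs"
  assumes cyc: "normalized_cycle n c xs" and inj: "inj c"
    and "u \<notin> x ` {m..m'}" "u \<in> {1..n + 1}"
  shows "c u \<in> x ` {m..m'} \<Longrightarrow> u = x (m - 1)"
    and "y \<in> x ` {m..m'} \<Longrightarrow> c y = u \<Longrightarrow> u = x (m' + 1)"
proof -
  have suc: "c (x t) = x (t + 1)" for t
    unfolding x_def by (rule cyclic_entry_Suc[OF cyc])
  show "u = x (m - 1)" if "c u \<in> x ` {m..m'}"
  proof -
    from that obtain t where t: "t \<in> {m..m'}" "c u = x t" by blast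
    then have "c u = c (x (t - 1))" using suc[of "t - 1"] by simp
    then have u: "u = x (t - 1)" using inj by (simp add: inj_eq)
    then have "t - 1 \<notin> {m..m'}" using assms(4) by blast
    then have "t = m" using t by auto
    then show ?thesis using u by simp
  qed
  show "u = x (m' + 1)" if "y \<in> x ` {m..m'}" "c y = u"
  proof -
    from that obtain t where t: "t \<in> {m..m'}" "u = x (t + 1)" using suc by blast
    then have "t + 1 \<notin> {m..m'}" using assms(4) by blast
    then have "t = m'" using t by auto
    then show ?thesis using t by simp
  qed
qed

lemma final_segment_cyclic_interval:
  assumes cyc: "normalized_cycle n (full_cox n Q) xs" and "1 \<le> i" "i \<le> n"
  shows "cyclic_entry n xs ` {m_res n Q i..m_res n Q i + int i - 1} = {n + 2 - i..n + 1}"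
  using assms(2,3)
proof (induction i rule: dec_induct)
  case base
  have "{m_res n Q 1..m_res n Q 1 + int 1 - 1} = {int n + 1}" by auto
  then show ?case
    using cyclic_entry_end[OF cyc] by (simp only: image_insert image_empty) simp
next
  case (step i)
  let ?c = "full_cox n Q" and ?x = "cyclic_entry n xs" and ?m = "m_res n Q i"
  \<comment> \<open>This is the vertex dual to i + 1; its arrow to a + 1 governs the recursion for
    \<open>m_res\<close>, and a + 1 is the point to be adjoined.\<close>
  define a where "a = n - i"
  have a: "a \<in> {1..<n}" "star n (Suc i) = a" "n + 2 - i = a + 2" "n + 2 - Suc i = a + 1"
    using step.hyps step.prems by (auto simp: a_def star_def)
  have IH: "?x ` {?m..?m + int i - 1} = {a + 2..n + 1}"
    using step.IH step.prems a by simp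
  have perm: "?c permutes {1..n + 1}" by (rule cox_permutes) simp
  note stp = cyclic_interval_step[OF cyc permutes_inj[OF perm], of "a + 1" ?m "?m + int i - 1"]
  have out: "a + 1 \<notin> ?x ` {?m..?m + int i - 1}" "a + 1 \<in> {1..n + 1}"
    using IH a by auto
  have ins: "{a + 1..n + 1} = insert (a + 1) {a + 2..n + 1}" using a by auto
  obtain l where l: "i = Suc l" using step.hyps by (cases i) auto
  have rec: "m_res n Q (Suc i) = (if (a, a + 1) \<in> Q then ?m else ?m - 1)"
    using a(2) unfolding l by (simp add: Let_def)
  show ?case
  proof (cases "(a, a + 1) \<in> Q")
    case True
    \<comment> \<open>The point a + 1 is entered from the current segment, so it follows the right
      end and the start index stays.\<close>
    then obtain y where y: "y > a + 1" "?c y = a + 1"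
      using cox_arrow_right[of a "{1..n}" Q n] a by auto
    then have "y \<in> {1..n + 1}" using permutes_in_image[OF perm, of y] a by auto
    then have "y \<in> ?x ` {?m..?m + int i - 1}" using IH y by auto
    then have u: "a + 1 = ?x (?m + int i)" using stp(2)[OF out _ y(2)] by simp
    have "{?m..?m + int (Suc i) - 1} = insert (?m + int i) {?m..?m + int i - 1}" by auto
    then have "?x ` {?m..?m + int (Suc i) - 1} = insert (a + 1) {a + 2..n + 1}"
      by (simp only: image_insert IH u[symmetric])
    then show ?thesis using rec True a ins by simp
  next
    case False
    \<comment> \<open>Here a + 1 is mapped into the current segment, so it precedes the left end and
      the start index drops by one.\<close>
    have "?c (a + 1) > a + 1" using cox_arrow_left[of a "{1..n}" Q n] a False by auto
    moreover have "?c (a + 1) \<in> {1..n + 1}"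
      using permutes_in_image[OF perm, of "a + 1"] a by auto
    ultimately have "?c (a + 1) \<in> ?x ` {?m..?m + int i - 1}" using IH by auto
    then have u: "a + 1 = ?x (?m - 1)" using stp(1)[OF out] by simp
    have "{?m - 1..?m - 1 + int (Suc i) - 1} = insert (?m - 1) {?m..?m + int i - 1}" by auto
    then have "?x ` {?m - 1..?m - 1 + int (Suc i) - 1} = insert (a + 1) {a + 2..n + 1}"
      by (simp only: image_insert IH u[symmetric])
    then show ?thesis using rec False a ins by simp
  qed
qed

lemma reversal_image_initial:
  assumes "i \<le> n"
  shows "reversal n ` {1..i} = {n + 2 - i..n + 1}"
proof
  show "{n + 2 - i..n + 1} \<subseteq> reversal n ` {1..i}"
  proof
    fix b assume "b \<in> {n + 2 - i..n + 1}"
    then have "b = reversal n (n + 2 - b)" "n + 2 - b \<in> {1..i}"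
      using assms by (auto simp: reversal_def)
    then show "b \<in> reversal n ` {1..i}" by blast
  qed
qed (use assms in \<open>auto simp: reversal_def\<close>)

section \<open>Counting the letters\<close>

lemma count_list_adapted:
  assumes "type_A_quiver n Q" "adapted n Q ws" "a \<in> {1..<n}"
  shows "int (count_list ws (a + 1)) - int (count_list ws a) =
    of_bool ((a, a + 1) \<in> Q) - of_bool ((a, a + 1) \<in> fold reflect_quiver ws Q)"
  using assms(1,2)
proof (induction ws arbitrary: Q)
  case (Cons k ws)
  let ?R = "reflect_quiver k Q"
  have IH: "int (count_list ws (a + 1)) - int (count_list ws a) =
    of_bool ((a, a + 1) \<in> ?R) - of_bool ((a, a + 1) \<in> fold reflect_quiver (k # ws) Q)"
    using Cons type_A_quiver_reflect by auto
  have "is_sink n Q k" using Cons.prems by simp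
  \<comment> \<open>The letter a creates the arrow from a to a + 1, and the letter a + 1 destroys
    it; the sink condition guarantees that each really occurs. Summing over the word
    telescopes.\<close>
  then have "of_bool ((a, a + 1) \<in> ?R) + of_bool (k = a + 1)
      = (of_bool ((a, a + 1) \<in> Q) + of_bool (k = a) :: int)"
    using is_sink_no_out[of n Q k "a + 1"] is_sink_no_out[of n Q k a]
      type_A_quiver_reverse[OF Cons.prems(1) assms(3)]
    by (auto simp: reflect_quiver_iff)
  moreover have "int (count_list (k # ws) j) = int (count_list ws j) + of_bool (k = j)" for j
    by simp
  ultimately show ?case using IH by (simp del: count_list.simps)
qed simp

text \<open>The final Coxeter element is the conjugate of the original one by the order-reversing
  w_0, and \<open>full_cox_less_iff\<close> reads the arrows off from both.\<close>

lemma fold_reflect_longest: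
  assumes "type_A_quiver n Q" "adapted n Q ws" "word_perm ws = reversal n" "a \<in> {1..<n}"
  shows "(a, a + 1) \<in> fold reflect_quiver ws Q \<longleftrightarrow> (n - a, n - a + 1) \<notin> Q"
proof -
  let ?R = "fold reflect_quiver ws Q" and ?d = "n - a"
  have d: "?d \<in> {1..<n}" "reversal n (a + 1) = ?d + 1" using assms(4) by (auto simp: reversal_def)
  have "full_cox n Q (?d + 1) = reversal n (full_cox n ?R (a + 1))"
    using fun_cong[OF full_cox_word_perm[OF assms(1,2)], of "a + 1"] d(2) assms(3) by simp
  moreover have "full_cox n ?R (a + 1) \<in> {1..n + 1}"
    using permutes_in_image[OF cox_permutes[of n n], of ?R "{1..n}" "a + 1"] assms(4) by simp
  \<comment> \<open>Excluding a fixed point makes the reversed inequality the exact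
    negation.\<close>
  moreover have "full_cox n ?R (a + 1) \<noteq> a + 1"
    using cox_arrow_right[of a "{1..n}" ?R n] cox_arrow_left[of a "{1..n}" ?R n] assms(4)
    by (cases "(a, a + 1) \<in> ?R") auto
  ultimately have "full_cox n Q (?d + 1) < ?d + 1 \<longleftrightarrow> \<not> full_cox n ?R (a + 1) < a + 1"
    using assms(4) by (auto simp: reversal_def)
  then show ?thesis using full_cox_less_iff d(1) assms(4) by blast
qed

lemma sum_count_list:
  assumes "finite S" "set ws \<subseteq> S"
  shows "(\<Sum>k\<in>S. count_list ws k) = length ws"
  using assms(2)
proof (induction ws)
  case (Cons a ws)
  have "(\<Sum>k\<in>S. count_list (a # ws) k) = (\<Sum>k\<in>S. count_list ws k + (if a = k then 1 else 0))"
    by (rule sum.cong) auto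
  then show ?case using Cons assms(1) by (simp add: sum.distrib)
qed simp

section \<open>Level sizes for an adapted expression of w_0\<close>

context
  fixes n Q ws
  assumes Q: "type_A_quiver n Q" and ad: "adapted n Q ws" and red: "word_perm ws = reversal n"
    and len: "2 * length ws = n * (n + 1)"
begin

lemma count_list_diff:
  assumes "a \<in> {1..<n}"
  shows "int (count_list ws (a + 1)) - int (count_list ws a) =
    of_bool ((a, a + 1) \<in> Q) + of_bool ((n - a, n - a + 1) \<in> Q) - 1"
  using count_list_adapted[OF Q ad assms] fold_reflect_longest[OF Q ad red assms] by auto

text \<open>The difference formula is symmetric under a \<mapsto> n - a, so the increments at k and
  at its dual cancel in the sum.\<close>

lemma count_list_star_const:
  assumes "1 \<le> k" "k \<le> n"
  shows "count_list ws k + count_list ws (n + 1 - k) = count_list ws 1 + count_list ws n"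
  using assms
proof (induction k rule: dec_induct)
  case (step k)
  then have k: "k \<in> {1..<n}" "n - k \<in> {1..<n}" "n - (n - k) = k" "n - k + 1 = n + 1 - k"
    by auto
  have "int (count_list ws (k + 1)) - int (count_list ws k)
      = int (count_list ws (n + 1 - k)) - int (count_list ws (n - k))"
    using count_list_diff[OF k(1)] count_list_diff[OF k(2)] unfolding k(3,4) by simp
  then show ?case using step by simp
qed simp

text \<open>Summing the constant over all n vertices counts each letter twice, which gives n (n +
  1).\<close>

lemma count_list_star:
  assumes "i \<in> {1..n}"
  shows "count_list ws i + count_list ws (n + 1 - i) = n + 1"
proof -
  let ?T = "count_list ws 1 + count_list ws n"
  have "(\<Sum>k\<in>{1..n}. count_list ws k) = length ws"
    using sum_count_list[of "{1..n}"] adapted_set[OF ad] by simp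
  moreover have "(\<Sum>k\<in>{1..n}. count_list ws (n + 1 - k)) = (\<Sum>k\<in>{1..n}. count_list ws k)"
    by (rule sum.reindex_bij_witness[of _ "\<lambda>k. n + 1 - k" "\<lambda>k. n + 1 - k"]) auto
  ultimately have "n * (n + 1) = (\<Sum>k\<in>{1..n}. count_list ws k + count_list ws (n + 1 - k))"
    using len by (simp add: sum.distrib)
  also have "\<dots> = (\<Sum>k\<in>{1..n}. ?T)"
    by (rule sum.cong) (use count_list_star_const in auto)
  finally have "n * (n + 1) = n * ?T" by simp
  then have "n + 1 = ?T" using assms by (subst (asm) mult_cancel1) simp
  then show ?thesis using count_list_star_const[of i] assms by simp
qed

text \<open>The differences telescope along the path from i to its dual. The path is symmetric under
  k \<mapsto> n - k, so the second indicator can be reindexed.\<close>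

lemma count_list_star_diff:
  assumes "i \<in> {1..n}" "i \<le> n + 1 - i"
  shows "int (count_list ws (n + 1 - i)) - int (count_list ws i) =
    (\<Sum>k\<in>{i..<n + 1 - i}. of_bool ((k, k + 1) \<in> Q))
    - (\<Sum>k\<in>{i..<n + 1 - i}. of_bool ((k + 1, k) \<in> Q))"
proof -
  let ?I = "{i..<n + 1 - i}"
  let ?N = "\<lambda>k. int (count_list ws k)"
  have I: "k \<in> {1..<n}" "n - k \<in> {1..<n}" "n - k \<in> ?I" if "k \<in> ?I" for k
    using that assms by auto
  have "?N (n + 1 - i) - ?N i = (\<Sum>k\<in>?I. ?N (Suc k) - ?N k)"
    by (rule sum_Suc_diff'[OF assms(2), symmetric])
  also have "\<dots> = (\<Sum>k\<in>?I. of_bool ((k, k + 1) \<in> Q) - of_bool ((n - k + 1, n - k) \<in> Q))"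
  proof (rule sum.cong)
    fix k assume "k \<in> ?I"
    then show "?N (Suc k) - ?N k = of_bool ((k, k + 1) \<in> Q) - of_bool ((n - k + 1, n - k) \<in> Q)"
      using count_list_diff[OF I(1)[of k]] type_A_quiver_reverse[OF Q I(2)[of k]] by auto
  qed simp
  also have "\<dots> = (\<Sum>k\<in>?I. of_bool ((k, k + 1) \<in> Q)) - (\<Sum>k\<in>?I. of_bool ((n - k + 1, n - k) \<in> Q))"
    by (rule sum_subtractf)
  also have "(\<Sum>k\<in>?I. of_bool ((n - k + 1, n - k) \<in> Q)) = (\<Sum>k\<in>?I. of_bool ((k + 1, k) \<in> Q) :: int)"
    by (rule sum.reindex_bij_witness[of _ "\<lambda>k. n - k" "\<lambda>k. n - k"]) (use I in auto)
  finally show ?thesis .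
qed

end

section \<open>Arrow counts as sums of indicators\<close>

lemma arrows_towards_left:
  assumes "type_A_quiver n Q" "p \<le> q"
  shows "int (arrows_towards Q p q) = (\<Sum>k\<in>{p..<q}. of_bool ((k + 1, k) \<in> Q))"
proof -
  have "{(a, b) \<in> Q. a \<in> {min p q..max p q} \<and> b \<in> {min p q..max p q} \<and>
      \<bar>int b - int p\<bar> < \<bar>int a - int p\<bar>} = (\<lambda>k. (k + 1, k)) ` {k \<in> {p..<q}. (k + 1, k) \<in> Q}"
    (is "?A = ?B")
  proof
    show "?A \<subseteq> ?B"
    proof
      fix e assume "e \<in> ?A"
      then obtain a b where e: "e = (a, b)" "(a, b) \<in> Q" "b < a" "a \<le> q" "p \<le> b"
        using assms(2) by auto
      then have "a = b + 1" using assms(1) by (auto simp: type_A_quiver_def)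
      then show "e \<in> ?B" using e by auto
    qed
  qed (use assms(2) in auto)
  then have "arrows_towards Q p q = card {k \<in> {p..<q}. (k + 1, k) \<in> Q}"
    unfolding arrows_towards_def by (simp add: card_image inj_on_def)
  then show ?thesis by (simp add: of_bool_def sum.If_cases Int_def)
qed

lemma arrows_towards_right:
  assumes "type_A_quiver n Q" "p \<le> q"
  shows "int (arrows_towards Q q p) = (\<Sum>k\<in>{p..<q}. of_bool ((k, k + 1) \<in> Q))"
proof -
  have "{(a, b) \<in> Q. a \<in> {min q p..max q p} \<and> b \<in> {min q p..max q p} \<and>
      \<bar>int b - int q\<bar> < \<bar>int a - int q\<bar>} = (\<lambda>k. (k, k + 1)) ` {k \<in> {p..<q}. (k, k + 1) \<in> Q}"
    (is "?A = ?B")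
  proof
    show "?A \<subseteq> ?B"
    proof
      fix e assume "e \<in> ?A"
      then obtain a b where e: "e = (a, b)" "(a, b) \<in> Q" "a < b" "b \<le> q" "p \<le> a"
        using assms(2) by auto
      then have "b = a + 1" using assms(1) by (auto simp: type_A_quiver_def)
      then show "e \<in> ?B" using e by auto
    qed
  qed (use assms(2) in auto)
  then have "arrows_towards Q q p = card {k \<in> {p..<q}. (k, k + 1) \<in> Q}"
    unfolding arrows_towards_def by (simp add: card_image inj_on_def)
  then show ?thesis by (simp add: of_bool_def sum.If_cases Int_def)
qed

theorem proposition4p3:
  fixes n i :: nat and Q :: quiver and ws xs :: "nat list" and c :: "nat \<Rightarrow> nat"
  assumes "type_A_quiver n Q"
    and "i \<in> {1..n}"
    and "reduced_expression n (longest_element n) ws"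
    and "adapted n Q ws"
    and "coxeter_element n Q c"
    and "normalized_cycle n c xs"
  shows "real (level_size ws i) =
           (real n + 1 + real (arrows_towards Q i (star n i))
                       - real (arrows_towards Q (star n i) i)) / 2 \<and>
         (\<forall>j<level_size ws i. level_index ws i j = cycle_index n xs (m_res n Q i - int j) i)"
proof
  note red = reduced_expression_longest[OF assms(3)]
  note star = count_list_star[OF assms(1,4) red(2,3)]
    and diff = count_list_star_diff[OF assms(1,4) red(2,3)]
  define i' where "i' = star n i"
  have i': "i' \<in> {1..n}" "i' = n + 1 - i" "i = n + 1 - i'"
    using assms(2) by (auto simp: i'_def star_def)
  have "int (count_list ws i') - int (count_list ws i)
      = int (arrows_towards Q i' i) - int (arrows_towards Q i i')"
  \<comment> \<open>The telescoped formula runs from the smaller vertex to the larger, so in the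
    second case it is applied to the dual vertex.\<close>
  proof (cases "i \<le> i'")
    case True
    then show ?thesis
      using diff[OF assms(2)] arrows_towards_left[OF assms(1) True]
        arrows_towards_right[OF assms(1) True] i'(2) by simp
  next
    case False
    then have le: "i' \<le> i" by simp
    then show ?thesis
      using diff[OF i'(1)] arrows_towards_left[OF assms(1) le]
        arrows_towards_right[OF assms(1) le] i'(3)[symmetric] by simp
  qed
  then have "2 * int (count_list ws i)
      = int n + 1 + int (arrows_towards Q i i') - int (arrows_towards Q i' i)"
    using star[OF assms(2)] i'(2) by simp
  then have "2 * real (count_list ws i)
      = real n + 1 + real (arrows_towards Q i i') - real (arrows_towards Q i' i)"
    by linarith
  then show "real (level_size ws i) = (real n + 1 + real (arrows_towards Q i (star n i))
      - real (arrows_towards Q (star n i) i)) / 2"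
    using level_size_eq_count[OF assms(1,4)] i'_def by simp
next
  have c: "c = full_cox n Q" by (rule coxeter_element_eq) fact+
  have inj: "inj c" unfolding c using permutes_inj[OF cox_permutes[of n n]] by simp
  have cyc: "normalized_cycle n (full_cox n Q) xs" using assms(6) c by simp
  show "\<forall>j<level_size ws i. level_index ws i j = cycle_index n xs (m_res n Q i - int j) i"
  proof (intro allI impI)
    fix j assume "j < level_size ws i"
    then have j: "j < count_list ws i" using level_size_eq_count[OF assms(1,4)] by simp
    let ?N = "count_list ws i" and ?x = "cyclic_entry n xs" and ?m = "m_res n Q i"
    \<comment> \<open>Both sides of (b) become w_0 {1, ..., i} after applying c j times; injectivity
      of c then removes these powers.\<close>
    have "(c ^^ j) ` (c ^^ (?N - j)) ` {1..i} = (c ^^ ?N) ` {1..i}"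
      using j by (simp only: image_comp funpow_add[symmetric] less_imp_le le_add_diff_inverse)
    also have "\<dots> = {n + 2 - i..n + 1}"
      using word_perm_image_initial[OF assms(1,4), of i] reversal_image_initial[of i n]
        reduced_expression_longest(2)[OF assms(3)] assms(2) c by simp
    also have "\<dots> = ?x ` {?m..?m + int i - 1}"
      using final_segment_cyclic_interval[OF cyc] assms(2) by simp
    also have "\<dots> = (c ^^ j) ` ?x ` {?m - int j..?m + int i - 1 - int j}"
      by (rule funpow_cyclic_interval[OF assms(6), symmetric])
    finally have "(c ^^ (?N - j)) ` {1..i} = ?x ` {?m - int j..?m + int i - 1 - int j}"
      by (simp only: inj_image_eq_iff[OF inj_fn[OF inj]])
    then show "level_index ws i j = cycle_index n xs (?m - int j) i"
      using level_index_eq[OF assms(1,4) j] c by (simp add: cycle_index_def algebra_simps)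
  qed
qed

end
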